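(* (a) There exist an infinite set $X$ and ideals $\mathcal I,\mathcal J$ on $X$ with $\mathtt{non}(\mathcal I)<\mathtt{cof}^{\mathcal J}(\mathcal I)$. (b) There exist an infinite set $X$ and ideals $\mathcal I,\mathcal J$ on $X$ with $\mathtt{cof}^{\mathcal J}(\mathcal I)<\mathtt{non}(\mathcal I)$. (c) There exist an infinite set $X$ and ideals $\mathcal I,\mathcal J$ on $X$ with $\mathtt{cov}(\mathcal I)<\mathtt{cof}^{\mathcal J}(\mathcal I)$. (d) There exist an infinite set $X$ and ideals $\mathcal I,\mathcal J$ on $X$ with $\mathtt{cof}^{\mathcal J}(\mathcal I)<\mathtt{cov}(\mathcal I)$.
   Context: An ideal on an infinite set $X$ is a family $\mathcal I\subseteq\mathcal P(X)$ closed under subsets and finite unions, with $X\notin\mathcal I$ and $[X]^{<\omega}\subseteq\mathcal I$. $\mathtt{cov}(\mathcal I)=\min\{|\mathcal A|:\mathcal A\subseteq\mathcal I,\ \bigcup\mathcal A=X\}$; $\mathtt{non}(\mathcal I)=\min\{|A|:A\subseteq X,\ A\notin\mathcal I\}$; $\mathtt{cof}^{\mathcal J}(\mathcal I)=\min\{|\mathcal A|:\mathcal A\subseteq\mathcal I,\ \forall I\in\mathcal I\ \exists A\in\mathcal A\ I\setminus A\in\mathcal J\}$. *)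

theory Defs
  imports Main
begin

unbundle cardinal_syntax

definition ideal_on :: "'a set \<Rightarrow> 'a set set \<Rightarrow> bool" where
  "ideal_on X I \<longleftrightarrow>
     I \<subseteq> Pow X \<and>
     (\<forall>A\<in>I. \<forall>B\<subseteq>A. B \<in> I) \<and>
     (\<forall>A\<in>I. \<forall>B\<in>I. A \<union> B \<in> I) \<and>
     X \<notin> I \<and>
     (\<forall>F\<subseteq>X. finite F \<longrightarrow> F \<in> I)"

text \<open>
  The least cardinality of a member of the family F. Cardinals are well-orders, here
  those of the form |A|, and are to be compared only up to order isomorphism, by the
  heterogeneous relations for less-or-equal, less and equal on well-orders (suffix o).
  The choice is therefore immaterial; a least element exists whenever F is nonempty
  (lemma min_card_attained).
\<close>
definition min_card :: "'a set set \<Rightarrow> 'a rel" where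
  "min_card F = (SOME r. r \<in> card_of ` F \<and> (\<forall>r'\<in>card_of ` F. r \<le>o r'))"

definition cov :: "'a set \<Rightarrow> 'a set set \<Rightarrow> 'a set rel" where
  "cov X I = min_card {\<A>. \<A> \<subseteq> I \<and> \<Union>\<A> = X}"

definition non :: "'a set \<Rightarrow> 'a set set \<Rightarrow> 'a rel" where
  "non X I = min_card {A. A \<subseteq> X \<and> A \<notin> I}"

definition cof :: "'a set set \<Rightarrow> 'a set set \<Rightarrow> 'a set rel" where
  "cof J I = min_card {\<A>. \<A> \<subseteq> I \<and> (\<forall>B\<in>I. \<exists>A\<in>\<A>. B - A \<in> J)}"

lemma min_card_attained:
  assumes "F \<noteq> {}"
  shows "\<exists>A\<in>F. min_card F = |A| \<and> (\<forall>B\<in>F. |A| \<le>o |B| )"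
proof -
  have "\<exists>r\<in>card_of ` F. \<forall>r'\<in>card_of ` F. r \<le>o r'"
    using assms by (intro exists_minim_Card_order) (auto intro: card_of_Card_order)
  then have "\<exists>r. r \<in> card_of ` F \<and> (\<forall>r'\<in>card_of ` F. r \<le>o r')"
    by blast
  then have "min_card F \<in> card_of ` F \<and> (\<forall>r'\<in>card_of ` F. min_card F \<le>o r')"
    unfolding min_card_def by (rule someI_ex)
  then show ?thesis
    by force
qed

lemma cov_family_nonempty:
  assumes "ideal_on X I"
  shows "{\<A>. \<A> \<subseteq> I \<and> \<Union>\<A> = X} \<noteq> {}"
proof -
  have "(\<lambda>x. {x}) ` X \<in> {\<A>. \<A> \<subseteq> I \<and> \<Union>\<A> = X}"
    using assms by (auto simp: ideal_on_def)
  then show ?thesis by blast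
qed

lemma non_family_nonempty:
  assumes "ideal_on X I"
  shows "{A. A \<subseteq> X \<and> A \<notin> I} \<noteq> {}"
  using assms by (auto simp: ideal_on_def)

lemma cof_family_nonempty:
  assumes "ideal_on X I" "ideal_on X J"
  shows "{\<A>. \<A> \<subseteq> I \<and> (\<forall>B\<in>I. \<exists>A\<in>\<A>. B - A \<in> J)} \<noteq> {}"
proof -
  have "{} \<in> J"
    using assms(2) by (auto simp: ideal_on_def)
  then have "I \<in> {\<A>. \<A> \<subseteq> I \<and> (\<forall>B\<in>I. \<exists>A\<in>\<A>. B - A \<in> J)}"
    by (auto intro!: bexI)
  then show ?thesis by blast
qed

end

theory Submission imports Defs "HOL-Library.Nat_Bijection"
begin

text \<open>
  For (b) and (d), take both ideals to be the finite sets: one set then suffices for the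
  cofinality modulo the ideal, while \<open>non\<close> and \<open>cov\<close> are infinite. For (a) and (c), work on a
  copy of \<open>\<nat> \<times> \<nat>\<close>, with the ideal of sets all of whose columns are finite and with the finite
  sets as second ideal. A column is a countable set outside the ideal and the rows are a
  countable cover, but given countably many members of the ideal one can choose in the \<open>n\<close>-th
  column a point outside the first \<open>n\<close> of them, and the set of the chosen points is not
  almost contained in any of them.
\<close>

lemma min_card_le:
  assumes "A \<in> F"
  shows "min_card F \<le>o |A|"
proof -
  from assms have "F \<noteq> {}"
    by blast
  from min_card_attained[OF this] obtain B where "min_card F = |B|" and "|B| \<le>o |A|"
    using assms by blast
  then show ?thesis
    by simp
qed

text \<open>The minimum is attained by a member of \<open>F\<close>, so a strict bound valid for all
  members passes to it.\<close>

lemma less_min_card: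
  assumes "F \<noteq> {}" and "\<And>A. A \<in> F \<Longrightarrow> r <o |A|"
  shows "r <o min_card F"
proof -
  from min_card_attained[OF assms(1)] obtain B where "B \<in> F" and "min_card F = |B|"
    by blast
  with assms(2) show ?thesis
    by simp
qed

lemma ideal_on_empty: "ideal_on X I \<Longrightarrow> {} \<in> I"
  by (simp add: ideal_on_def)

lemma ideal_on_Union_finite:
  assumes "ideal_on X I" and "finite \<A>" and "\<A> \<subseteq> I"
  shows "\<Union>\<A> \<in> I"
  using assms(2,3)
proof (induction rule: finite_induct)
  case empty
  then show ?case using ideal_on_empty[OF assms(1)] by simp
next
  case (insert A \<A>)
  then show ?case using assms(1) by (simp add: ideal_on_def)
qed

lemma ideal_on_finite_subsets:
  assumes "infinite X"
  shows "ideal_on X {A. A \<subseteq> X \<and> finite A}"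
  using assms by (auto simp: ideal_on_def intro: finite_subset)

lemma card_of_finite_less_infinite:
  assumes "finite A" and "infinite B"
  shows "|A| <o |B|"
  using assms by (intro finite_ordLess_infinite card_of_Well_order) (simp_all add: Field_card_of)

text \<open>Modulo \<open>I\<close> itself every \<open>B\<close> in \<open>I\<close> is negligible,
  so the family with the empty set as its only member is already cofinal.\<close>

lemma cof_self_le_singleton:
  fixes X :: "'a set"
  assumes "ideal_on X I"
  shows "cof I I \<le>o |{{} :: 'a set}|"
  unfolding cof_def using ideal_on_empty[OF assms] by (intro min_card_le) simp

text \<open>All finite subsets of \<open>X\<close> belong to \<open>I\<close>, so a subset outside
  \<open>I\<close> is infinite and exceeds the singleton bound.\<close>

lemma cof_self_less_non:
  assumes "ideal_on X I"
  shows "cof I I <o non X I"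
proof -
  have "|{{}}| <o non X I"
    unfolding non_def
  proof (rule less_min_card[OF non_family_nonempty[OF assms]])
    fix A assume "A \<in> {A. A \<subseteq> X \<and> A \<notin> I}"
    then have "infinite A"
      using assms by (auto simp: ideal_on_def)
    then show "|{{}}| <o |A|"
      by (intro card_of_finite_less_infinite) simp_all
  qed
  with cof_self_le_singleton[OF assms] show ?thesis
    by (rule ordLeq_ordLess_trans)
qed

text \<open>A finite subfamily of \<open>I\<close> has its union in \<open>I\<close>, whereas
  \<open>X\<close> is not in \<open>I\<close>; hence every cover is infinite.\<close>

lemma cof_self_less_cov:
  assumes "ideal_on X I"
  shows "cof I I <o cov X I"
proof -
  have "|{{}}| <o cov X I"
    unfolding cov_def
  proof (rule less_min_card[OF cov_family_nonempty[OF assms]])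
    fix \<A> assume "\<A> \<in> {\<A>. \<A> \<subseteq> I \<and> \<Union>\<A> = X}"
    then have "infinite \<A>"
      using assms ideal_on_Union_finite[OF assms, of \<A>] by (auto simp: ideal_on_def)
    then show "|{{}}| <o |\<A>|"
      by (intro card_of_finite_less_infinite) simp_all
  qed
  with cof_self_le_singleton[OF assms] show ?thesis
    by (rule ordLeq_ordLess_trans)
qed

text \<open>This is the ideal usually written as the product of the trivial ideal and Fin, with
  \<open>g n k\<close> as the \<open>k\<close>-th point of column \<open>n\<close>. The parameter
  \<open>g\<close> places the grid inside an arbitrary type.\<close>

definition fin_columns :: "(nat \<Rightarrow> nat \<Rightarrow> 'a) \<Rightarrow> 'a set set" where
  "fin_columns g = {A. A \<subseteq> (\<Union>n. range (g n)) \<and> (\<forall>n. finite {k. g n k \<in> A})}"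

context
  fixes g :: "nat \<Rightarrow> nat \<Rightarrow> 'a" and X :: "'a set"
  assumes inj: "\<And>m j n k. g m j = g n k \<Longrightarrow> m = n \<and> j = k"
  defines "X \<equiv> \<Union>n. range (g n)"
begin

lemma inj_column: "inj (g n)"
  by (rule injI) (blast dest: inj)

lemma infinite_grid: "infinite X"
proof -
  have "infinite (range (g 0))"
    using inj_column by (simp add: finite_image_iff)
  moreover have "range (g 0) \<subseteq> X"
    by (auto simp: X_def)
  ultimately show ?thesis
    using finite_subset by blast
qed

lemma ideal_on_fin_columns: "ideal_on X (fin_columns g)"
  unfolding ideal_on_def
proof (intro conjI ballI allI impI)
  show "fin_columns g \<subseteq> Pow X"
    by (auto simp: fin_columns_def X_def)
next
  fix A B assume "A \<in> fin_columns g" "B \<subseteq> A"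
  moreover have "finite {k. g n k \<in> B}" for n
  proof (rule finite_subset)
    show "{k. g n k \<in> B} \<subseteq> {k. g n k \<in> A}"
      using \<open>B \<subseteq> A\<close> by blast
    show "finite {k. g n k \<in> A}"
      using \<open>A \<in> fin_columns g\<close> by (simp add: fin_columns_def)
  qed
  ultimately show "B \<in> fin_columns g"
    unfolding fin_columns_def by blast
next
  fix A B assume "A \<in> fin_columns g" "B \<in> fin_columns g"
  moreover have "{k. g n k \<in> A \<union> B} = {k. g n k \<in> A} \<union> {k. g n k \<in> B}" for n
    by blast
  ultimately show "A \<union> B \<in> fin_columns g"
    by (auto simp: fin_columns_def)
next
  have "{k. g n k \<in> X} = UNIV" for n
    by (auto simp: X_def)
  then show "X \<notin> fin_columns g"
    by (simp add: fin_columns_def)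
next
  fix F assume "F \<subseteq> X" "finite F"
  moreover have "finite {k. g n k \<in> F}" for n
    using finite_vimageI[OF \<open>finite F\<close> inj_column, of n] by (simp add: vimage_def)
  ultimately show "F \<in> fin_columns g"
    by (auto simp: fin_columns_def X_def)
qed

lemma non_fin_columns_le: "non X (fin_columns g) \<le>o |UNIV :: nat set|"
proof -
  have "infinite {k. g 0 k \<in> range (g 0)}"
    by simp
  then have "range (g 0) \<notin> fin_columns g"
    unfolding fin_columns_def by blast
  then have "non X (fin_columns g) \<le>o |range (g 0)|"
    unfolding non_def X_def by (intro min_card_le) auto
  then show ?thesis
    using card_of_image by (rule ordLeq_transitive)
qed

lemma cov_fin_columns_le: "cov X (fin_columns g) \<le>o |UNIV :: nat set|"
proof -
  define row where "row k = range (\<lambda>n. g n k)" for k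
  \<comment> \<open>A row meets each column in a single point, by injectivity of \<open>g\<close> on
    pairs.\<close>
  have "{j. g n j \<in> row k} \<subseteq> {k}" for n k
    by (auto simp: row_def dest: inj)
  then have "finite {j. g n j \<in> row k}" for n k
    using finite_subset by blast
  then have "row k \<in> fin_columns g" for k
    unfolding fin_columns_def by (auto simp: row_def)
  moreover have "\<Union>(range row) = X"
    by (auto simp: row_def X_def)
  ultimately have "cov X (fin_columns g) \<le>o |range row|"
    unfolding cov_def by (intro min_card_le) auto
  then show ?thesis
    using card_of_image by (rule ordLeq_transitive)
qed

text \<open>Diagonalization with one point per column: \<open>B\<close> then meets every column in
  one point, and the point in column \<open>n\<close> avoids \<open>E 0\<close>, ...,
  \<open>E n\<close>.\<close>

lemma countable_not_cofinal_fin_columns: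
  assumes "range E \<subseteq> fin_columns g"
  shows "\<exists>B\<in>fin_columns g. \<forall>m::nat. infinite (B - E m)"
proof -
  have "\<exists>k. \<forall>m\<le>n. g n k \<notin> E m" for n
  proof -
    \<comment> \<open>Only finitely many sets have to be avoided in column \<open>n\<close>, and
      each has a finite trace there.\<close>
    have "finite (\<Union>m\<le>n. {k. g n k \<in> E m})"
      using assms by (auto simp: fin_columns_def)
    then obtain k where "k \<notin> (\<Union>m\<le>n. {k. g n k \<in> E m})"
      using ex_new_if_finite[OF infinite_UNIV_nat] by blast
    then show ?thesis by blast
  qed
  then have "\<exists>f. \<forall>n. \<forall>m\<le>n. g n (f n) \<notin> E m"
    by (intro choice) blast
  then obtain f where f: "\<And>m n. m \<le> n \<Longrightarrow> g n (f n) \<notin> E m"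
    by blast
  define B where "B = range (\<lambda>n. g n (f n))"
  have "{k. g n k \<in> B} \<subseteq> {f n}" for n
    by (auto simp: B_def dest: inj)
  then have "finite {k. g n k \<in> B}" for n
    using finite_subset by blast
  then have "B \<in> fin_columns g"
    unfolding fin_columns_def by (auto simp: B_def)
  moreover have "infinite (B - E m)" for m
  proof -
    \<comment> \<open>\<open>E m\<close> may contain points chosen in columns before
      \<open>m\<close>, so only the tail from \<open>m\<close> on is used; its points are distinct
      because their columns are.\<close>
    have "inj_on (\<lambda>n. g n (f n)) {m..}"
      by (rule inj_onI) (blast dest: inj)
    then have "infinite ((\<lambda>n. g n (f n)) ` {m..})"
      by (simp add: finite_image_iff infinite_Ici)
    moreover have "(\<lambda>n. g n (f n)) ` {m..} \<subseteq> B - E m"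
      using f by (auto simp: B_def)
    ultimately show ?thesis
      using finite_subset by blast
  qed
  ultimately show ?thesis by blast
qed

lemma less_cof_fin_columns: "|UNIV :: nat set| <o cof {A. A \<subseteq> X \<and> finite A} (fin_columns g)"
  unfolding cof_def
proof (rule less_min_card)
  show "{\<A>. \<A> \<subseteq> fin_columns g \<and>
      (\<forall>B\<in>fin_columns g. \<exists>A\<in>\<A>. B - A \<in> {A. A \<subseteq> X \<and> finite A})} \<noteq> {}"
    using ideal_on_fin_columns ideal_on_finite_subsets[OF infinite_grid]
    by (rule cof_family_nonempty)
next
  fix \<A>
  assume \<A>: "\<A> \<in> {\<A>. \<A> \<subseteq> fin_columns g \<and>
      (\<forall>B\<in>fin_columns g. \<exists>A\<in>\<A>. B - A \<in> {A. A \<subseteq> X \<and> finite A})}"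
  have "\<not> |\<A>| \<le>o |UNIV :: nat set|"
  proof
    assume "|\<A>| \<le>o |UNIV :: nat set|"
    \<comment> \<open>Nonemptiness is needed to enumerate \<open>\<A>\<close> by a surjection from
      the naturals; it holds since the member \<open>{}\<close> of the ideal must be almost covered
      by some set in \<open>\<A>\<close>.\<close>
    moreover have "\<A> \<noteq> {}"
      using \<A> ideal_on_empty[OF ideal_on_fin_columns] by auto
    ultimately obtain E :: "nat \<Rightarrow> 'a set" where "range E = \<A>"
      using card_of_ordLeq2 by metis
    with \<A> obtain B where "B \<in> fin_columns g" and "\<And>m. infinite (B - E m)"
      using countable_not_cofinal_fin_columns[of E] by blast
    with \<A> \<open>range E = \<A>\<close> show False
      by blast
  qed
  then show "|UNIV :: nat set| <o |\<A>|"
    by (simp add: not_ordLeq_iff_ordLess card_of_Well_order)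
qed

end

theorem theorem3p10:
  assumes "infinite (UNIV :: 'a set)"
  shows
    "(\<exists>(X :: 'a set) I J. infinite X \<and> ideal_on X I \<and> ideal_on X J \<and> non X I <o cof J I) \<and>
     (\<exists>(X :: 'a set) I J. infinite X \<and> ideal_on X I \<and> ideal_on X J \<and> cof J I <o non X I) \<and>
     (\<exists>(X :: 'a set) I J. infinite X \<and> ideal_on X I \<and> ideal_on X J \<and> cov X I <o cof J I) \<and>
     (\<exists>(X :: 'a set) I J. infinite X \<and> ideal_on X I \<and> ideal_on X J \<and> cof J I <o cov X I)"
proof -
  obtain h :: "nat \<Rightarrow> 'a" where h: "inj h"
    using assms infinite_countable_subset[of "UNIV :: 'a set"] by auto
  \<comment> \<open>Pairing followed by an embedding of the naturals copies the grid into
    \<open>'a\<close>, injectively in both coordinates together.\<close>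
  define g where "g n k = h (prod_encode (n, k))" for n k
  have inj: "m = n \<and> j = k" if "g m j = g n k" for m j n k
    using that by (simp add: g_def inj_eq[OF h] prod_encode_eq)
  define X where "X = (\<Union>n. range (g n))"
  let ?fin = "{A. A \<subseteq> X \<and> finite A}" and ?cols = "fin_columns g"
  note grid [unfolded X_def [symmetric]] =
    infinite_grid [of g, OF inj] ideal_on_fin_columns [of g, OF inj]
    non_fin_columns_le [of g, OF inj] cov_fin_columns_le [of g, OF inj]
    less_cof_fin_columns [of g, OF inj]
  have fin: "ideal_on X ?fin"
    using grid(1) by (rule ideal_on_finite_subsets)
  have "infinite X \<and> ideal_on X ?cols \<and> ideal_on X ?fin \<and> non X ?cols <o cof ?fin ?cols"
    using grid(1,2) fin ordLeq_ordLess_trans[OF grid(3,5)] by (intro conjI)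
  moreover have "infinite X \<and> ideal_on X ?fin \<and> ideal_on X ?fin \<and> cof ?fin ?fin <o non X ?fin"
    using grid(1) fin cof_self_less_non[OF fin] by (intro conjI)
  moreover have "infinite X \<and> ideal_on X ?cols \<and> ideal_on X ?fin \<and> cov X ?cols <o cof ?fin ?cols"
    using grid(1,2) fin ordLeq_ordLess_trans[OF grid(4,5)] by (intro conjI)
  moreover have "infinite X \<and> ideal_on X ?fin \<and> ideal_on X ?fin \<and> cof ?fin ?fin <o cov X ?fin"
    using grid(1) fin cof_self_less_cov[OF fin] by (intro conjI)
  ultimately show ?thesis
    by - (intro conjI; (rule exI)+; assumption)
qed

end
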